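(* There is a randomized algorithm that, given a distance matrix $A\in\mathbb R^{n\times m}$ and $\delta\in(0,1)$, runs in time $O(m+n)$, reads $O(m+n)$ entries of $A$, and outputs a probability distribution $(p_1,\ldots,p_n)$ on $[n]$ that with probability $1-\delta$ satisfies $p_i \geq \Omega(\delta)\cdot \|A_{i,*}\|_2^2/\|A\|_F^2$ for every $i=1,\ldots,n$ (the constant in $\Omega$ being absolute).
   Context: A matrix $A\in\mathbb R^{n\times m}$ is a distance matrix if there is a metric space $(\mathcal Z,\mathrm d)$ and points $x_1,\dots,x_n,y_1,\dots,y_m\in\mathcal Z$ with $A_{ij}=\mathrm d(x_i,y_j)$. $A_{i,*}$ denotes the $i$-th row of $A$. *)

theory Defs
  imports "HOL-Probability.Probability" "Jordan_Normal_Form.Matrix"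
begin

section \<open>Distance matrices and norms\<close>

text \<open>
  HOL cannot quantify over the type carrying the metric space. Nothing is lost by letting the
  carrier be a set of natural numbers, since only the finitely many points of the two families
  matter: \<open>distance_matrixI\<close> below derives the predicate from a metric space on any type.
  Rows and columns are numbered from \<open>0\<close>.
\<close>

definition distance_matrix :: "real mat \<Rightarrow> bool" where
  "distance_matrix A \<longleftrightarrow>
    (\<exists>(Z :: nat set) d x y. Metric_space Z d \<and>
       (\<forall>i < dim_row A. x (i::nat) \<in> Z) \<and> (\<forall>j < dim_col A. y (j::nat) \<in> Z) \<and>
       (\<forall>i < dim_row A. \<forall>j < dim_col A. A $$ (i, j) = d (x i) (y j)))"

lemma distance_matrixI:
  fixes Z :: "'a set" and x y :: "nat \<Rightarrow> 'a"
  assumes "Metric_space Z d"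
    and x: "\<And>i. i < dim_row A \<Longrightarrow> x i \<in> Z"
    and y: "\<And>j. j < dim_col A \<Longrightarrow> y j \<in> Z"
    and A: "\<And>i j. i < dim_row A \<Longrightarrow> j < dim_col A \<Longrightarrow> A $$ (i, j) = d (x i) (y j)"
  shows "distance_matrix A"
proof -
  interpret Metric_space Z d by fact
  define F where "F = x ` {..<dim_row A} \<union> y ` {..<dim_col A}"
  have "finite F" and sub: "F \<subseteq> Z"
    using x y by (auto simp: F_def)
  then obtain f :: "'a \<Rightarrow> nat" where f: "inj_on f F"
    using finite_imp_inj_to_nat_seg by metis
  define g where "g = inv_into F f"
  have g: "g (f z) = z" if "z \<in> F" for z
    using f that by (simp add: g_def)
  have gZ: "g u \<in> Z" if "u \<in> f ` F" for u
    using that g sub by auto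
  have "Metric_space (f ` F) (\<lambda>u v. d (g u) (g v))"
  proof
    fix u v w
    show "0 \<le> d (g u) (g v)" by simp
    show "d (g u) (g v) = d (g v) (g u)" by (rule commute)
    show "d (g u) (g v) = 0 \<longleftrightarrow> u = v" if "u \<in> f ` F" "v \<in> f ` F"
      using that gZ g by (metis imageE zero)
    show "d (g u) (g w) \<le> d (g u) (g v) + d (g v) (g w)"
      if "u \<in> f ` F" "v \<in> f ` F" "w \<in> f ` F"
      using that gZ by (intro triangle) auto
  qed
  moreover have "x i \<in> F" if "i < dim_row A" for i using that by (auto simp: F_def)
  moreover have "y j \<in> F" if "j < dim_col A" for j using that by (auto simp: F_def)
  ultimately show ?thesis
    unfolding distance_matrix_def
    by (intro exI[of _ "f ` F"] exI[of _ "\<lambda>u v. d (g u) (g v)"]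
          exI[of _ "\<lambda>i. f (x i)"] exI[of _ "\<lambda>j. f (y j)"]) (simp add: g A)
qed

definition norm2 :: "real vec \<Rightarrow> real" where
  "norm2 v = L2_set (vec_index v) {..<dim_vec v}"

definition frob_norm :: "real mat \<Rightarrow> real" where
  "frob_norm A = L2_set (\<lambda>ij. A $$ ij) ({..<dim_row A} \<times> {..<dim_col A})"

definition prob_vector :: "nat \<Rightarrow> (nat \<Rightarrow> real) \<Rightarrow> bool" where
  "prob_vector n p \<longleftrightarrow> (\<forall>i<n. 0 \<le> p i) \<and> (\<Sum>i<n. p i) = 1"

section \<open>A randomized real RAM with query access to a matrix\<close>

text \<open>
  The machine has natural number registers, real registers, and an indirectly addressed memory
  of each kind. Every instruction costs one time step. As usual for unit-cost models, natural
  numbers are only added and subtracted (truncated at \<open>0\<close>), and there is no rounding from reals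
  to natural numbers. Programs contain no real constants, so a program is a finite object.
  Register operands come destination first.
\<close>

datatype instr =
    ConstN nat nat          \<comment> \<open>load a constant\<close>
  | AddN nat nat nat
  | SubN nat nat nat
  | LoadN nat nat           \<comment> \<open>register, address register\<close>
  | StoreN nat nat          \<comment> \<open>address register, register\<close>
  | OfNat nat nat           \<comment> \<open>real register, natural number register\<close>
  | AddR nat nat nat
  | SubR nat nat nat
  | MulR nat nat nat
  | DivR nat nat nat
  | LoadR nat nat           \<comment> \<open>register, address register\<close>
  | StoreR nat nat          \<comment> \<open>address register, register\<close>
  | Query nat nat nat       \<comment> \<open>read the entry whose row and column are in two registers\<close>
  | Sample nat nat          \<comment> \<open>uniform number below the content of a register\<close>
  | Jump nat
  | JumpLessN nat nat nat   \<comment> \<open>two registers, jump target\<close>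
  | JumpLessR nat nat nat   \<comment> \<open>two registers, jump target\<close>

type_synonym program = "instr list"

record config =
  pc :: nat
  nreg :: "nat \<Rightarrow> nat"
  rreg :: "nat \<Rightarrow> real"
  nmem :: "nat \<Rightarrow> nat"
  rmem :: "nat \<Rightarrow> real"
  reads :: nat

definition set_nreg :: "nat \<Rightarrow> nat \<Rightarrow> config \<Rightarrow> config" where
  "set_nreg k v s = s\<lparr>nreg := (nreg s)(k := v)\<rparr>"

definition set_rreg :: "nat \<Rightarrow> real \<Rightarrow> config \<Rightarrow> config" where
  "set_rreg k v s = s\<lparr>rreg := (rreg s)(k := v)\<rparr>"

definition entry :: "real mat \<Rightarrow> nat \<Rightarrow> nat \<Rightarrow> real" where
  "entry A i j = (if i < dim_row A \<and> j < dim_col A then A $$ (i, j) else 0)"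

definition uniform_below :: "nat \<Rightarrow> nat pmf" where
  "uniform_below k = (if k = 0 then return_pmf 0 else pmf_of_set {..<k})"

text \<open>
  In \<open>exec_instr\<close> the program counter already points to the next instruction; jumps overwrite it.
  The field \<open>reads\<close> counts all executed queries, including repeated ones.
\<close>

fun exec_instr :: "real mat \<Rightarrow> instr \<Rightarrow> config \<Rightarrow> config pmf" where
  "exec_instr A (ConstN a k) s = return_pmf (set_nreg a k s)"
| "exec_instr A (AddN a b c) s = return_pmf (set_nreg a (nreg s b + nreg s c) s)"
| "exec_instr A (SubN a b c) s = return_pmf (set_nreg a (nreg s b - nreg s c) s)"
| "exec_instr A (LoadN a b) s = return_pmf (set_nreg a (nmem s (nreg s b)) s)"
| "exec_instr A (StoreN a b) s = return_pmf (s\<lparr>nmem := (nmem s)(nreg s a := nreg s b)\<rparr>)"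
| "exec_instr A (OfNat a b) s = return_pmf (set_rreg a (real (nreg s b)) s)"
| "exec_instr A (AddR a b c) s = return_pmf (set_rreg a (rreg s b + rreg s c) s)"
| "exec_instr A (SubR a b c) s = return_pmf (set_rreg a (rreg s b - rreg s c) s)"
| "exec_instr A (MulR a b c) s = return_pmf (set_rreg a (rreg s b * rreg s c) s)"
| "exec_instr A (DivR a b c) s = return_pmf (set_rreg a (rreg s b / rreg s c) s)"
| "exec_instr A (LoadR a b) s = return_pmf (set_rreg a (rmem s (nreg s b)) s)"
| "exec_instr A (StoreR a b) s = return_pmf (s\<lparr>rmem := (rmem s)(nreg s a := rreg s b)\<rparr>)"
| "exec_instr A (Query a b c) s =
     return_pmf ((set_rreg a (entry A (nreg s b) (nreg s c)) s)\<lparr>reads := Suc (reads s)\<rparr>)"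
| "exec_instr A (Sample a b) s = map_pmf (\<lambda>v. set_nreg a v s) (uniform_below (nreg s b))"
| "exec_instr A (Jump l) s = return_pmf (s\<lparr>pc := l\<rparr>)"
| "exec_instr A (JumpLessN a b l) s =
     return_pmf (if nreg s a < nreg s b then s\<lparr>pc := l\<rparr> else s)"
| "exec_instr A (JumpLessR a b l) s =
     return_pmf (if rreg s a < rreg s b then s\<lparr>pc := l\<rparr> else s)"

definition halted :: "program \<Rightarrow> config \<Rightarrow> bool" where
  "halted P s \<longleftrightarrow> length P \<le> pc s"

definition step :: "program \<Rightarrow> real mat \<Rightarrow> config \<Rightarrow> config pmf" where
  "step P A s =
    (if halted P s then return_pmf s else exec_instr A (P ! pc s) (s\<lparr>pc := Suc (pc s)\<rparr>))"

fun run :: "program \<Rightarrow> real mat \<Rightarrow> nat \<Rightarrow> config \<Rightarrow> config pmf" where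
  "run P A 0 s = return_pmf s"
| "run P A (Suc t) s = bind_pmf (step P A s) (run P A t)"

text \<open>
  The dimensions are passed in the natural number registers \<open>0\<close> and \<open>1\<close>, the failure probability
  in the real register \<open>0\<close>; the matrix itself is accessible through \<open>Query\<close> only. The output
  vector is left in the cells \<open>0, \<dots>, n - 1\<close> of the real memory.
\<close>

definition init_config :: "nat \<Rightarrow> nat \<Rightarrow> real \<Rightarrow> config" where
  "init_config n m \<delta> =
    \<lparr>pc = 0, nreg = (\<lambda>_. 0)(0 := n, 1 := m), rreg = (\<lambda>_. 0)(0 := \<delta>),
     nmem = (\<lambda>_. 0), rmem = (\<lambda>_. 0), reads = 0\<rparr>"

end

theory Submission
  imports Defs
begin

text \<open>
  Draw a row \<open>i\<close> and a column \<open>j\<close> uniformly and independently, and let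
  \<open>w k = (A k j)\<^sup>2 + (A i j)\<^sup>2 + (\<Sum>l. (A i l)\<^sup>2) / m\<close> be the unnormalised weight of row \<open>k\<close>. Going from
  \<open>x k\<close> to \<open>y l\<close> through \<open>y j\<close> and \<open>x i\<close> shows that row \<open>k\<close> has squared norm at most \<open>3 m w k\<close>,
  for every choice of \<open>i\<close> and \<open>j\<close>. On the other hand the total weight has expectation \<open>3 / m\<close> times
  the squared Frobenius norm, so by Markov's inequality it exceeds \<open>1 / \<delta>\<close> times this value with
  probability at most \<open>\<delta>\<close>. Hence the constant \<open>1/9\<close>.
\<close>

section \<open>The distribution of the total weight\<close>

text \<open>The part of the weight shared by all rows \<open>k\<close>; the program computes it
  once, before it scans column \<open>j\<close>.\<close>

definition pivot_weight :: "(nat \<Rightarrow> nat \<Rightarrow> real) \<Rightarrow> nat \<Rightarrow> nat \<Rightarrow> nat \<Rightarrow> real" where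
  "pivot_weight a m i j = (a i j)\<^sup>2 + (\<Sum>l<m. (a i l)\<^sup>2) / real m"

definition total_weight :: "(nat \<Rightarrow> nat \<Rightarrow> real) \<Rightarrow> nat \<Rightarrow> nat \<Rightarrow> nat \<Rightarrow> nat \<Rightarrow> real" where
  "total_weight a n m i j = (\<Sum>k<n. (a k j)\<^sup>2 + pivot_weight a m i j)"

lemma pivot_weight_nonneg: "0 \<le> pivot_weight a m i j"
  by (simp add: pivot_weight_def sum_nonneg)

lemma total_weight_nonneg: "0 \<le> total_weight a n m i j"
  by (simp add: total_weight_def sum_nonneg pivot_weight_nonneg)

text \<open>Serves the branch of the program in which the total weight vanishes and cannot be
  divided by.\<close>

lemma total_weight_eq_0D:
  assumes "\<not> 0 < total_weight a n m i j" "k < n"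
  shows "(a k j)\<^sup>2 + pivot_weight a m i j = 0"
proof -
  have "(\<Sum>k<n. (a k j)\<^sup>2 + pivot_weight a m i j) = 0"
    using assms(1) total_weight_nonneg[of a n m i j] by (simp add: total_weight_def)
  then show ?thesis
    using assms(2) by (subst (asm) sum_nonneg_eq_0_iff) (auto simp: pivot_weight_nonneg)
qed

text \<open>Each of the three summands of the weight contributes \<open>n\<close> times the sum of
  all squared entries; for the row average, the sum over \<open>j\<close> cancels the division by
  \<open>m\<close>.\<close>

lemma sum_total_weight:
  assumes "0 < m"
  shows "(\<Sum>i<n. \<Sum>j<m. total_weight a n m i j) = 3 * real n * (\<Sum>i<n. \<Sum>j<m. (a i j)\<^sup>2)"
proof -
  have "(\<Sum>j<m. \<Sum>k<n. (a k j)\<^sup>2) = (\<Sum>i<n. \<Sum>j<m. (a i j)\<^sup>2)"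
    by (rule sum.swap)
  then show ?thesis
    using assms
    by (simp add: total_weight_def pivot_weight_def sum.distrib distrib_left
        flip: sum_distrib_left sum_divide_distrib)
qed

lemma row_sum_le_weight:
  fixes a :: "nat \<Rightarrow> nat \<Rightarrow> real"
  assumes nonneg: "\<And>l. l < m \<Longrightarrow> 0 \<le> a k l"
    and path: "\<And>l. l < m \<Longrightarrow> a k l \<le> a k j + a i j + a i l"
    and m: "0 < m"
  shows "(\<Sum>l<m. (a k l)\<^sup>2) \<le> 3 * real m * ((a k j)\<^sup>2 + pivot_weight a m i j)"
proof -
  have "(a k l)\<^sup>2 \<le> 3 * ((a k j)\<^sup>2 + (a i j)\<^sup>2) + 3 * (a i l)\<^sup>2" if "l < m" for l
  proof -
    have "(a k l)\<^sup>2 \<le> (a k j + a i j + a i l)\<^sup>2"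
      using nonneg path that by (intro power_mono) auto
    \<comment> \<open>The right side minus the left is the sum of the squared pairwise differences
      of the three terms.\<close>
    also have "\<dots> \<le> 3 * ((a k j)\<^sup>2 + (a i j)\<^sup>2) + 3 * (a i l)\<^sup>2"
      using sum_squares_ge_zero[of "a k j - a i j" "a k j - a i l"]
        zero_le_square[of "a i j - a i l"]
      by (simp add: power2_eq_square algebra_simps)
    finally show ?thesis .
  qed
  then have "(\<Sum>l<m. (a k l)\<^sup>2) \<le> (\<Sum>l<m. 3 * ((a k j)\<^sup>2 + (a i j)\<^sup>2) + 3 * (a i l)\<^sup>2)"
    by (intro sum_mono) auto
  also have "\<dots> = 3 * real m * ((a k j)\<^sup>2 + pivot_weight a m i j)"
    using m by (simp add: pivot_weight_def sum.distrib algebra_simps flip: sum_distrib_left)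
  finally show ?thesis .
qed

lemma prob_total_weight_le:
  fixes a :: "nat \<Rightarrow> nat \<Rightarrow> real"
  assumes n: "0 < n" and m: "0 < m" and \<delta>: "0 < \<delta>"
  defines "F \<equiv> \<Sum>i<n. \<Sum>j<m. (a i j)\<^sup>2"
  assumes F: "0 < F"
  shows "measure_pmf.prob (pair_pmf (uniform_below n) (uniform_below m))
      {(i, j). total_weight a n m i j \<le> 3 * F / (real m * \<delta>)} \<ge> 1 - \<delta>"
proof -
  define U where "U = pmf_of_set ({..<n} \<times> {..<m})"
  have U: "pair_pmf (uniform_below n) (uniform_below m) = U"
    using n m by (intro pmf_eqI)
      (auto simp: U_def uniform_below_def lessThan_empty_iff pmf_pair indicator_def)
  have setU: "set_pmf U = {..<n} \<times> {..<m}"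
    using n m by (simp add: U_def lessThan_empty_iff)
  define X where "X = (\<lambda>(i, j). total_weight a n m i j)"
  \<comment> \<open>The expectation of \<open>X\<close> divided by \<open>\<delta>\<close>, so that
    Markov's inequality yields exactly \<open>\<delta>\<close>.\<close>
  define t where "t = 3 * F / (real m * \<delta>)"
  have t: "0 < t" using F m \<delta> by (simp add: t_def)
  have "measure_pmf.expectation U X = (\<Sum>ij\<in>{..<n} \<times> {..<m}. X ij) / (real n * real m)"
    using n m by (simp add: U_def integral_pmf_of_set lessThan_empty_iff card_cartesian_product)
  also have "\<dots> = 3 * F / real m"
    using n m by (simp add: X_def F_def sum_total_weight flip: sum.cartesian_product)
  finally have E: "measure_pmf.expectation U X = t * \<delta>"
    using \<delta> by (simp add: t_def)
  have "measure_pmf.prob U {u \<in> space (measure_pmf U). t \<le> X u} \<le> measure_pmf.expectation U X / t"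
    using t by (intro integral_Markov_inequality_measure[where A = "{}"])
      (auto simp: X_def total_weight_nonneg setU intro: integrable_measure_pmf_finite)
  then have "measure_pmf.prob U {u. t \<le> X u} \<le> \<delta>"
    using E t by simp
  moreover have "measure_pmf.prob U {u. X u \<le> t} \<ge> measure_pmf.prob U (- {u. t \<le> X u})"
    by (intro measure_pmf.finite_measure_mono) auto
  moreover have "measure_pmf.prob U (- {u. t \<le> X u}) = 1 - measure_pmf.prob U {u. t \<le> X u}"
    using measure_pmf.prob_compl[of "{u. t \<le> X u}" U] by (simp add: Compl_eq_Diff_UNIV)
  moreover have "{(i, j). total_weight a n m i j \<le> t} = {u. X u \<le> t}"
    by (auto simp: X_def)
  ultimately show ?thesis
    unfolding U t_def[symmetric] by simp
qed

section \<open>Reasoning about deterministic program fragments\<close>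

text \<open>\<open>return_pmf\<close> expresses that the fragment draws no randomness;
  \<open>t\<close> is only an upper bound because branches may differ in length.\<close>

definition leads_to ::
  "program \<Rightarrow> real mat \<Rightarrow> nat \<Rightarrow> (config \<Rightarrow> bool) \<Rightarrow> (config \<Rightarrow> bool) \<Rightarrow> bool" where
  "leads_to P A t I J \<longleftrightarrow>
    (\<forall>s. I s \<longrightarrow> (\<exists>t' \<le> t. \<exists>s'. run P A t' s = return_pmf s' \<and> J s'))"

lemma run_add: "run P A (t + u) s = bind_pmf (run P A t s) (run P A u)"
proof (induction t arbitrary: s)
  case 0
  then show ?case by (simp add: bind_return_pmf)
next
  case (Suc t)
  then have "run P A (t + u) = (\<lambda>s. bind_pmf (run P A t s) (run P A u))" by blast
  then show ?case by (simp add: bind_assoc_pmf)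
qed

lemma run_halted: "halted P s \<Longrightarrow> run P A t s = return_pmf s"
  by (induction t) (simp_all add: step_def bind_return_pmf)

lemma leads_to_trans:
  assumes "leads_to P A t I J" "leads_to P A u J K"
  shows "leads_to P A (t + u) I K"
  unfolding leads_to_def
proof (intro allI impI)
  fix s assume "I s"
  then obtain t' s' where 1: "t' \<le> t" "run P A t' s = return_pmf s'" "J s'"
    using assms(1) unfolding leads_to_def by blast
  then obtain u' s'' where 2: "u' \<le> u" "run P A u' s' = return_pmf s''" "K s''"
    using assms(2) unfolding leads_to_def by blast
  have "run P A (t' + u') s = return_pmf s''"
    using 1 2 by (simp add: run_add bind_return_pmf)
  then show "\<exists>t'\<le>t + u. \<exists>s'. run P A t' s = return_pmf s' \<and> K s'"
    using 1 2 by (meson add_mono)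
qed

lemma leads_to_loop:
  assumes "\<And>k. k < N \<Longrightarrow> leads_to P A t (I k) (I (Suc k))"
  shows "leads_to P A (N * t) (I 0) (I N)"
  using assms
proof (induction N)
  case 0
  then show ?case by (auto simp: leads_to_def)
next
  case (Suc N)
  then have "leads_to P A (N * t + t) (I 0) (I (Suc N))"
    by (intro leads_to_trans[where J = "I N"]) auto
  then show ?case by (simp add: add.commute)
qed

text \<open>A halted configuration no longer changes, so a run that halts early can be padded to any
  fixed length \<open>T\<close>.\<close>

lemma leads_to_haltedD:
  assumes "leads_to P A t I J" "I s" "\<And>s. J s \<Longrightarrow> halted P s" "t \<le> T"
  shows "\<exists>s'. run P A T s = return_pmf s' \<and> J s'"
proof -
  obtain t' s' where 1: "t' \<le> t" "run P A t' s = return_pmf s'" "J s'"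
    using assms unfolding leads_to_def by blast
  then have "run P A (t' + (T - t')) s = return_pmf s'"
    using assms(3) by (simp add: run_add bind_return_pmf run_halted)
  then show ?thesis
    using 1 assms(4) by auto
qed

section \<open>The program\<close>

text \<open>Natural registers 2, 3, 4, 5 hold \<open>i\<close>, \<open>j\<close>, the loop counter
  and 1. Real register 1 becomes the pivot weight, 3 the total weight, and 4 stays 0. All loops test
  at the end, which is sound for positive \<open>n\<close> and \<open>m\<close>.\<close>

definition row_sampler :: program where
  "row_sampler =
   [Sample 2 0,
    Sample 3 1,
    ConstN 5 1,
    Query 2 2 4,       \<comment> \<open>3: loop over the entries of row \<open>i\<close>\<close>
    MulR 2 2 2,
    AddR 1 1 2,
    AddN 4 4 5,
    JumpLessN 4 1 3,
    OfNat 2 1,         \<comment> \<open>8\<close>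
    DivR 1 1 2,
    Query 2 2 3,
    MulR 2 2 2,
    AddR 1 1 2,
    ConstN 4 0,
    Query 2 4 3,       \<comment> \<open>14: loop over the entries of column \<open>j\<close>\<close>
    MulR 2 2 2,
    StoreR 4 2,
    AddR 3 3 2,
    AddR 3 3 1,
    AddN 4 4 5,
    JumpLessN 4 0 14,
    JumpLessR 4 3 24,  \<comment> \<open>21: if the total weight vanishes, give all rows weight \<open>1\<close>\<close>
    OfNat 3 0,
    OfNat 1 5,
    ConstN 4 0,        \<comment> \<open>24\<close>
    LoadR 2 4,         \<comment> \<open>25: normalisation loop\<close>
    AddR 2 2 1,
    DivR 2 2 3,
    StoreR 4 2,
    AddN 4 4 5,
    JumpLessN 4 0 25]"

lemma row_sampler_length: "length row_sampler = 31"
  by (simp add: row_sampler_def)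

lemma run_numeral:
  "run P A (numeral t) s = bind_pmf (step P A s) (run P A (pred_numeral t))"
  by (simp add: numeral_eq_Suc)

lemma step_row_sampler:
  "pc s < 31 \<Longrightarrow>
    step row_sampler A s = exec_instr A (row_sampler ! pc s) (s\<lparr>pc := Suc (pc s)\<rparr>)"
  by (simp add: step_def halted_def row_sampler_length)

text \<open>Symbolic execution: the program is unfolded only under \<open>!\<close>, and each step
  needs a concrete \<open>pc\<close>, which the proofs below first extract from the
  invariant.\<close>

lemmas row_sampler_run =
  run_numeral step_row_sampler arg_cong[OF row_sampler_def, of "\<lambda>P. P ! k" for k]
  bind_return_pmf set_nreg_def set_rreg_def

section \<open>Loop invariants and their preservation\<close>

context
  fixes A :: "real mat" and n m i j :: nat
begin

abbreviation (input) "q \<equiv> pivot_weight (entry A) m i j"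
abbreviation (input) "W \<equiv> total_weight (entry A) n m i j"

text \<open>The conditional on \<open>pc\<close> lets one predicate describe the loop head after
  \<open>k\<close> rounds and, at \<open>k = m\<close>, the loop exit. Real registers 3 and 4 are
  tracked because later phases rely on their being 0.\<close>

definition row_inv :: "nat \<Rightarrow> config \<Rightarrow> bool" where
  "row_inv k s \<longleftrightarrow> pc s = (if k < m then 3 else 8) \<and>
     nreg s 0 = n \<and> nreg s 1 = m \<and> nreg s 2 = i \<and> nreg s 3 = j \<and> nreg s 4 = k \<and> nreg s 5 = 1 \<and>
     rreg s 1 = (\<Sum>l<k. (entry A i l)\<^sup>2) \<and> rreg s 3 = 0 \<and> rreg s 4 = 0 \<and> reads s = k"

text \<open>The extra 1 in \<open>reads\<close> is the separate query of entry \<open>(i, j)\<close>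
  after the row loop.\<close>

definition col_inv :: "nat \<Rightarrow> config \<Rightarrow> bool" where
  "col_inv k s \<longleftrightarrow> pc s = (if k < n then 14 else 21) \<and>
     nreg s 0 = n \<and> nreg s 3 = j \<and> nreg s 4 = k \<and> nreg s 5 = 1 \<and>
     rreg s 1 = q \<and> rreg s 3 = (\<Sum>l<k. (entry A l j)\<^sup>2 + q) \<and> rreg s 4 = 0 \<and>
     (\<forall>l<k. rmem s l = (entry A l j)\<^sup>2) \<and> reads s = m + 1 + k"

text \<open>If the total weight vanishes, all stored squares are 0, and offset 1 with divisor
  \<open>n\<close> gives the uniform distribution.\<close>

definition offset :: real where "offset = (if 0 < W then q else 1)"
definition divisor :: real where "divisor = (if 0 < W then W else real n)"

definition norm_inv :: "nat \<Rightarrow> config \<Rightarrow> bool" where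
  "norm_inv k s \<longleftrightarrow> pc s = (if k < n then 25 else 31) \<and>
     nreg s 0 = n \<and> nreg s 4 = k \<and> nreg s 5 = 1 \<and> rreg s 1 = offset \<and> rreg s 3 = divisor \<and>
     (\<forall>l<n. rmem s l =
        (if l < k then ((entry A l j)\<^sup>2 + offset) / divisor else (entry A l j)\<^sup>2)) \<and>
     reads s = m + 1 + n"

lemma leads_to_row: "leads_to row_sampler A (m * 5) (row_inv 0) (row_inv m)"
proof (rule leads_to_loop)
  fix k assume k: "k < m"
  have "\<exists>s'. run row_sampler A 5 s = return_pmf s' \<and> row_inv (Suc k) s'" if s: "row_inv k s" for s
  proof -
    have "pc s = 3" "nreg s 1 = m" "nreg s 2 = i" "nreg s 4 = k" "nreg s 5 = 1"
      using s k by (simp_all add: row_inv_def)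
    then show ?thesis
      using s by (auto simp: row_inv_def row_sampler_run power2_eq_square)
  qed
  then show "leads_to row_sampler A 5 (row_inv k) (row_inv (Suc k))"
    unfolding leads_to_def by blast
qed

lemma leads_to_pivot: "0 < n \<Longrightarrow> leads_to row_sampler A 6 (row_inv m) (col_inv 0)"
proof -
  assume n: "0 < n"
  have "\<exists>s'. run row_sampler A 6 s = return_pmf s' \<and> col_inv 0 s'" if s: "row_inv m s" for s
  proof -
    have "pc s = 8" "nreg s 1 = m" "nreg s 2 = i" "nreg s 3 = j"
      using s by (simp_all add: row_inv_def)
    then show ?thesis
      using s n by (auto simp: row_inv_def col_inv_def row_sampler_run power2_eq_square
          pivot_weight_def)
  qed
  then show ?thesis
    unfolding leads_to_def by blast
qed

lemma leads_to_col: "leads_to row_sampler A (n * 7) (col_inv 0) (col_inv n)"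
proof (rule leads_to_loop)
  fix k assume k: "k < n"
  have "\<exists>s'. run row_sampler A 7 s = return_pmf s' \<and> col_inv (Suc k) s'" if s: "col_inv k s" for s
  proof -
    have "pc s = 14" "nreg s 0 = n" "nreg s 3 = j" "nreg s 4 = k" "nreg s 5 = 1"
      using s k by (simp_all add: col_inv_def)
    then show ?thesis
      using s by (auto simp: col_inv_def row_sampler_run power2_eq_square less_Suc_eq)
  qed
  then show "leads_to row_sampler A 7 (col_inv k) (col_inv (Suc k))"
    unfolding leads_to_def by blast
qed

lemma leads_to_divisor: "0 < n \<Longrightarrow> leads_to row_sampler A 4 (col_inv n) (norm_inv 0)"
proof -
  assume n: "0 < n"
  have "\<exists>t'\<le>4. \<exists>s'. run row_sampler A t' s = return_pmf s' \<and> norm_inv 0 s'" if s: "col_inv n s" for s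
  proof -
    have pc: "pc s = 21" "rreg s 4 = 0" "rreg s 3 = W"
      using s by (simp_all add: col_inv_def total_weight_def)
    show ?thesis
    proof (cases "0 < W")
      case True
      \<comment> \<open>With the jump taken only the test and \<open>ConstN 4 0\<close> are
        executed, against four instructions otherwise.\<close>
      then have "\<exists>s'. run row_sampler A 2 s = return_pmf s' \<and> norm_inv 0 s'"
        using s n pc by (auto simp: col_inv_def norm_inv_def row_sampler_run
            offset_def divisor_def)
      then show ?thesis by (intro exI[of _ 2]) simp
    next
      case False
      then have "\<exists>s'. run row_sampler A 4 s = return_pmf s' \<and> norm_inv 0 s'"
        using s n pc by (auto simp: col_inv_def norm_inv_def row_sampler_run
            offset_def divisor_def)
      then show ?thesis by (intro exI[of _ 4]) simp
    qed
  qed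
  then show ?thesis
    unfolding leads_to_def by blast
qed

lemma leads_to_norm: "leads_to row_sampler A (n * 6) (norm_inv 0) (norm_inv n)"
proof (rule leads_to_loop)
  fix k assume k: "k < n"
  have "\<exists>s'. run row_sampler A 6 s = return_pmf s' \<and> norm_inv (Suc k) s'" if s: "norm_inv k s" for s
  proof -
    have "pc s = 25" "nreg s 0 = n" "nreg s 4 = k" "nreg s 5 = 1" "rmem s k = (entry A k j)\<^sup>2"
      using s k by (simp_all add: norm_inv_def)
    then show ?thesis
      using s by (auto simp: norm_inv_def row_sampler_run less_Suc_eq)
  qed
  then show "leads_to row_sampler A 6 (norm_inv k) (norm_inv (Suc k))"
    unfolding leads_to_def by blast
qed

lemma leads_to_output:
  assumes "0 < n"
  shows "leads_to row_sampler A (5 * m + 13 * n + 10) (row_inv 0) (norm_inv n)"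
proof -
  have "leads_to row_sampler A (m * 5 + (6 + (n * 7 + (4 + n * 6)))) (row_inv 0) (norm_inv n)"
    using leads_to_row leads_to_pivot leads_to_col leads_to_divisor leads_to_norm assms
    by (meson leads_to_trans)
  then show ?thesis by (simp add: algebra_simps)
qed

lemma norm_inv_halted: "norm_inv n s \<Longrightarrow> halted row_sampler s"
  by (simp add: norm_inv_def halted_def row_sampler_length)

lemma norm_inv_prob_vector:
  assumes n: "0 < n" and s: "norm_inv n s"
  shows "prob_vector n (rmem s)"
proof -
  have div: "0 < divisor" and off: "0 \<le> offset"
    using n by (auto simp: divisor_def offset_def pivot_weight_nonneg)
  have rmem: "rmem s k = ((entry A k j)\<^sup>2 + offset) / divisor" if "k < n" for k
    using s that by (simp add: norm_inv_def)
  have "(\<Sum>k<n. (entry A k j)\<^sup>2 + offset) = divisor"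
  proof (cases "0 < W")
    case True
    then show ?thesis by (simp add: divisor_def offset_def total_weight_def)
  next
    case False
    \<comment> \<open>Nonnegative summands with sum zero: column \<open>j\<close> vanishes, and only
      the \<open>n\<close> offsets 1 remain.\<close>
    then have "entry A k j = 0" if "k < n" for k
      using that total_weight_eq_0D[of "entry A" n m i j k] pivot_weight_nonneg[of "entry A" m i j]
      by (metis add_nonneg_eq_0_iff zero_eq_power2 zero_le_power2)
    then show ?thesis using False by (simp add: divisor_def offset_def)
  qed
  then have "(\<Sum>k<n. rmem s k) = 1"
    using div by (simp add: rmem flip: sum_divide_distrib)
  then show ?thesis
    using div off by (simp add: prob_vector_def rmem)
qed

end

text \<open>Only the two \<open>Sample\<close> instructions are random, so the output law is the
  image of a uniform pair. Since \<open>entry\<close> is 0 out of range, the claim on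
  \<open>f\<close> holds for all \<open>i\<close> and \<open>j\<close>.\<close>

lemma run_row_sampler:
  assumes "0 < n" "0 < m"
  obtains f where
    "run row_sampler A (20 * (m + n)) (init_config n m \<delta>) =
       map_pmf (\<lambda>(i, j). f i j) (pair_pmf (uniform_below n) (uniform_below m))"
    and "\<And>i j. norm_inv A n m i j n (f i j)"
proof -
  \<comment> \<open>The 3 counts the instructions before the first loop; 20 suffices since
    \<open>3 + (5 * m + 13 * n + 10)\<close> is at most \<open>20 * (m + n)\<close> for positive
    \<open>n\<close> and \<open>m\<close>.\<close>
  define T where "T = 20 * (m + n) - 3"
  define s where "s = (\<lambda>i j. (init_config n m \<delta>)
    \<lparr>pc := 3, nreg := (\<lambda>_. 0)(0 := n, 1 := m, 2 := i, 3 := j, 5 := 1)\<rparr>)"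
  have "run row_sampler A 3 (init_config n m \<delta>) =
    bind_pmf (uniform_below n) (\<lambda>i. bind_pmf (uniform_below m) (\<lambda>j. return_pmf (s i j)))"
    by (simp add: row_sampler_run init_config_def s_def map_pmf_def bind_assoc_pmf numeral_3_eq_3
        fun_upd_twist)
  moreover have "20 * (m + n) = 3 + T"
    using assms by (simp add: T_def)
  ultimately have run: "run row_sampler A (20 * (m + n)) (init_config n m \<delta>) =
    bind_pmf (uniform_below n) (\<lambda>i. bind_pmf (uniform_below m) (\<lambda>j. run row_sampler A T (s i j)))"
    by (simp only: run_add bind_assoc_pmf bind_return_pmf)
  have "\<exists>s'. run row_sampler A T (s i j) = return_pmf s' \<and> norm_inv A n m i j n s'" for i j
  proof (rule leads_to_haltedD[OF leads_to_output])
    show "row_inv A n m i j 0 (s i j)"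
      using assms by (simp add: row_inv_def s_def init_config_def)
  qed (use assms in \<open>auto simp: T_def norm_inv_halted\<close>)
  then obtain f where f: "\<And>i j. run row_sampler A T (s i j) = return_pmf (f i j)"
      "\<And>i j. norm_inv A n m i j n (f i j)"
    by metis
  show thesis
    by (rule that[of f]) (simp_all only: run f pair_pmf_def map_bind_pmf map_return_pmf prod.case)
qed

section \<open>Distance matrices\<close>

lemma distance_matrix_nonneg:
  assumes "distance_matrix A" "k < dim_row A" "l < dim_col A"
  shows "0 \<le> entry A k l"
proof -
  obtain Z :: "nat set" and d x y where "Metric_space Z d"
    "\<forall>i < dim_row A. \<forall>j < dim_col A. A $$ (i, j) = d (x i :: nat) (y j)"
    using assms unfolding distance_matrix_def by blast
  then show ?thesis
    using assms by (simp add: entry_def Metric_space.nonneg)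
qed

lemma distance_matrix_path:
  assumes "distance_matrix A"
    and "k < dim_row A" "i < dim_row A" "j < dim_col A" "l < dim_col A"
  shows "entry A k l \<le> entry A k j + entry A i j + entry A i l"
proof -
  obtain Z :: "nat set" and d x y where d: "Metric_space Z d"
    and x: "\<forall>i < dim_row A. x (i::nat) \<in> Z" and y: "\<forall>j < dim_col A. y (j::nat) \<in> Z"
    and A: "\<forall>i < dim_row A. \<forall>j < dim_col A. A $$ (i, j) = d (x i) (y j)"
    using assms(1) unfolding distance_matrix_def by blast
  interpret Metric_space Z d by fact
  \<comment> \<open>The distance \<open>d (y j) (y l)\<close> is not given by an entry of
    \<open>A\<close>; the second triangle trades it for two entries of row \<open>i\<close>.\<close>
  have "d (x k) (y l) \<le> d (x k) (y j) + d (y j) (y l)"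
    using x y assms by (intro triangle) auto
  also have "d (y j) (y l) \<le> d (y j) (x i) + d (x i) (y l)"
    using x y assms by (intro triangle) auto
  finally show ?thesis
    using A assms by (simp add: entry_def commute)
qed

section \<open>From the output of the program to the bound by row norms\<close>

lemma norm2_row:
  assumes "A \<in> carrier_mat n m" "k < n"
  shows "(norm2 (Matrix.row A k))\<^sup>2 = (\<Sum>l<m. (entry A k l)\<^sup>2)"
  using assms by (auto simp: norm2_def L2_set_def sum_nonneg entry_def intro!: sum.cong)

lemma frob_norm_entry:
  assumes "A \<in> carrier_mat n m"
  shows "(frob_norm A)\<^sup>2 = (\<Sum>k<n. \<Sum>l<m. (entry A k l)\<^sup>2)"
  using assms
  by (auto simp: frob_norm_def L2_set_def sum_nonneg entry_def sum.cartesian_product intro!: sum.cong)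

text \<open>The row norm bound \<open>3 * m * w\<close> and the bound \<open>W\<close> on the total
  weight each contribute a factor 3, which gives the 9, while \<open>m\<close> cancels.\<close>

lemma norm_inv_lower_bound:
  assumes A: "A \<in> carrier_mat n m" "distance_matrix A"
    and i: "i < n" and j: "j < m" and k: "k < n" and \<delta>: "0 < \<delta>"
    and s: "norm_inv A n m i j n s" and F: "0 < (frob_norm A)\<^sup>2"
    and W: "total_weight (entry A) n m i j \<le> 3 * (frob_norm A)\<^sup>2 / (real m * \<delta>)"
  shows "1 / 9 * \<delta> * ((norm2 (Matrix.row A k))\<^sup>2 / (frob_norm A)\<^sup>2) \<le> rmem s k"
proof -
  let ?W = "total_weight (entry A) n m i j"
  define w where "w = (entry A k j)\<^sup>2 + pivot_weight (entry A) m i j"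
  have m: "0 < m" using j by simp
  have w0: "0 \<le> w" by (simp add: w_def pivot_weight_nonneg)
  have row: "(norm2 (Matrix.row A k))\<^sup>2 \<le> 3 * real m * w"
    unfolding norm2_row[OF A(1) k] w_def using A i j k m
    by (intro row_sum_le_weight distance_matrix_nonneg distance_matrix_path) auto
  show ?thesis
  proof (cases "0 < ?W")
    case True
    then have rmem: "rmem s k = w / ?W"
      using s k by (simp add: norm_inv_def offset_def divisor_def w_def)
    have "1 / 9 * \<delta> * ((norm2 (Matrix.row A k))\<^sup>2 / (frob_norm A)\<^sup>2)
        \<le> 1 / 9 * \<delta> * ((3 * real m * w) / (frob_norm A)\<^sup>2)"
      using row \<delta> F by (intro mult_left_mono divide_right_mono) auto
    also have "\<dots> = w / (3 * (frob_norm A)\<^sup>2 / (real m * \<delta>))"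
      using F m \<delta> by (simp add: field_simps)
    also have "\<dots> \<le> w / ?W"
      using w0 W True F m \<delta> by (intro divide_left_mono mult_pos_pos divide_pos_pos) auto
    finally show ?thesis unfolding rmem .
  next
    case False
    \<comment> \<open>By the row norm bound a zero weight forces a zero row, so a nonnegative output
      suffices.\<close>
    then have "w = 0"
      unfolding w_def using k by (rule total_weight_eq_0D)
    then have "norm2 (Matrix.row A k) = 0"
      using row by simp
    moreover have "0 \<le> rmem s k"
      using norm_inv_prob_vector[OF _ s] k by (simp add: prob_vector_def)
    ultimately show ?thesis by simp
  qed
qed

theorem theorem3p1:
  shows "\<exists>(P :: program) (C :: nat) (c :: real). c > 0 \<and>
    (\<forall>(n :: nat) (m :: nat) (A :: real mat) (\<delta> :: real).
      n \<ge> 1 \<longrightarrow> m \<ge> 1 \<longrightarrow> A \<in> carrier_mat n m \<longrightarrow> distance_matrix A \<longrightarrow> 0 < \<delta> \<longrightarrow> \<delta> < 1 \<longrightarrow>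
      (let \<mu> = run P A (C * (m + n)) (init_config n m \<delta>) in
        (\<forall>s \<in> set_pmf \<mu>. halted P s \<and> reads s \<le> C * (m + n) \<and> prob_vector n (rmem s)) \<and>
        measure_pmf.prob \<mu>
          {s. \<forall>i<n. rmem s i \<ge> c * \<delta> * ((norm2 (Matrix.row A i))\<^sup>2 / (frob_norm A)\<^sup>2)}
          \<ge> 1 - \<delta>))"
proof (intro exI[of _ row_sampler] exI[of _ "20 :: nat"] exI[of _ "1 / 9 :: real"] conjI allI impI)
  fix n m :: nat and A :: "real mat" and \<delta> :: real
  assume "1 \<le> n" "1 \<le> m" and A: "A \<in> carrier_mat n m" "distance_matrix A" and \<delta>: "0 < \<delta>" "\<delta> < 1"
  then have n: "0 < n" and m: "0 < m" by auto
  define \<mu> where "\<mu> = run row_sampler A (20 * (m + n)) (init_config n m \<delta>)"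
  define U where "U = pair_pmf (uniform_below n) (uniform_below m)"
  obtain f where \<mu>: "\<mu> = map_pmf (\<lambda>(i, j). f i j) U" and f: "\<And>i j. norm_inv A n m i j n (f i j)"
    using run_row_sampler[OF n m] unfolding \<mu>_def U_def by metis
  define good where
    "good = {s :: config. \<forall>i<n. rmem s i \<ge> 1 / 9 * \<delta> * ((norm2 (Matrix.row A i))\<^sup>2 / (frob_norm A)\<^sup>2)}"
  have all: "halted row_sampler s \<and> reads s \<le> 20 * (m + n) \<and> prob_vector n (rmem s)"
    if s_in: "s \<in> set_pmf \<mu>" for s
  proof -
    obtain i j where s: "norm_inv A n m i j n s"
      using s_in f unfolding \<mu> by auto
    then have "reads s = m + 1 + n" by (simp add: norm_inv_def)
    then show ?thesis
      using norm_inv_halted[OF s] norm_inv_prob_vector[OF n s] n by simp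
  qed
  have "1 - \<delta> \<le> measure_pmf.prob \<mu> good"
  proof (cases "frob_norm A = 0")
    case True
    \<comment> \<open>Division by 0 yields 0, so \<open>good\<close> asks only for nonnegative
      outputs, which every run delivers.\<close>
    have "measure_pmf.prob \<mu> good = 1"
      using all by (subst measure_pmf.prob_eq_1)
        (auto simp: AE_measure_pmf_iff good_def True prob_vector_def)
    then show ?thesis using \<delta> by simp
  next
    case False
    then have F: "0 < (frob_norm A)\<^sup>2" by simp
    let ?B = "{(i, j). total_weight (entry A) n m i j \<le> 3 * (frob_norm A)\<^sup>2 / (real m * \<delta>)}"
    have supp: "set_pmf U = {..<n} \<times> {..<m}"
      using n m by (simp add: U_def uniform_below_def lessThan_empty_iff)
    have "1 - \<delta> \<le> measure_pmf.prob U ?B"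
      using prob_total_weight_le[OF n m \<delta>(1), of "entry A"] F A
      by (simp add: U_def frob_norm_entry)
    \<comment> \<open>The inclusion is shown on the support of \<open>U\<close> only, where
      \<open>i < n\<close> and \<open>j < m\<close> as the lower bound requires.\<close>
    also have "\<dots> \<le> measure_pmf.prob U ((\<lambda>(i, j). f i j) -` good)"
    proof (rule measure_pmf.finite_measure_mono_AE)
      show "AE u in measure_pmf U. u \<in> ?B \<longrightarrow> u \<in> (\<lambda>(i, j). f i j) -` good"
        using norm_inv_lower_bound[OF A _ _ _ \<delta>(1) f F]
        by (auto simp: AE_measure_pmf_iff supp good_def)
    qed auto
    also have "\<dots> = measure_pmf.prob \<mu> good"
      by (simp add: \<mu>)
    finally show ?thesis .
  qed
  then show "let \<mu> = run row_sampler A (20 * (m + n)) (init_config n m \<delta>) in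
        (\<forall>s \<in> set_pmf \<mu>. halted row_sampler s \<and> reads s \<le> 20 * (m + n) \<and> prob_vector n (rmem s)) \<and>
        measure_pmf.prob \<mu>
          {s. \<forall>i<n. rmem s i \<ge> 1 / 9 * \<delta> * ((norm2 (Matrix.row A i))\<^sup>2 / (frob_norm A)\<^sup>2)}
          \<ge> 1 - \<delta>"
    using all unfolding Let_def \<mu>_def[symmetric] good_def by blast
qed simp

end
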